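(* Let $m\ge 2$ and $n\ge m+1$ be integers. Then $\#\mathcal{R}_{\{m\}}(n)=F_{n-m}F_{m-1}$, where $F_k$ denotes the $k$th Fibonacci number.
   Context: Fibonacci numbers: $F_1=F_2=1$ and $F_k=F_{k-1}+F_{k-2}$ for $k\geq 3$. A rim hook is a (nonempty, connected) skew shape, drawn in English notation (row $1$ at the top) and considered up to translation, that contains no $2\times 2$ square; its length is its number of squares. A rim hook of length $n$ can be read from its bottom-left end to its top-right end as a sequence of squares $s_1,\dots,s_n$, where each $s_{j+1}$ is immediately to the right of or immediately above $s_j$. A rim hook tableau is a filling of the squares with $1,\dots,n$, each used once, such that for any two vertically adjacent squares the upper one contains the smaller number, and for any two horizontally adjacent squares the left one contains the smaller number. Reading the entries along $s_1,\dots,s_n$ gives a permutation $w=[w_1,\dots,w_n]$ of $\{1,\dots,n\}$, with $w_j>w_{j+1}$ exactly when $s_{j+1}$ is above $s_j$; hence all tableaux of a given rim hook give permutations with the same descents. A double descent of a permutation $w$ of $\{1,\dots,n\}$ is an index $i$ with $2\le i\le n-1$ and $w_{i-1}>w_i>w_{i+1}$; the double descent set of $w$ is the set of its double descents. For a finite set $I$ of positive integers, $\mathcal{R}_I(n)$ denotes the set of all rim hooks of length $n$ whose corresponding permutations have double descent set $I$. *)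

theory Defs
  imports "HOL-Number_Theory.Fib"
begin

text \<open>
  A square is a pair \<open>(i, j)\<close> of a row \<open>i\<close> and a column \<open>j\<close>. Following the English convention,
  rows are numbered from top to bottom, so \<open>(i - 1, j)\<close> lies immediately above \<open>(i, j)\<close>.
\<close>

type_synonym square = "int \<times> int"

definition is_partition :: "(nat \<Rightarrow> nat) \<Rightarrow> bool" where
  "is_partition p \<longleftrightarrow> antimono p \<and> (\<exists>N. \<forall>i\<ge>N. p i = 0)"

definition skew_diagram :: "(nat \<Rightarrow> nat) \<Rightarrow> (nat \<Rightarrow> nat) \<Rightarrow> square set" where
  "skew_diagram lam mu = {(int i, int j) | i j. mu i \<le> j \<and> j < lam i}"

definition translate_by :: "int \<Rightarrow> int \<Rightarrow> square set \<Rightarrow> square set" where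
  "translate_by a b S = (\<lambda>(i, j). (i + a, j + b)) ` S"

definition translation_rel :: "(square set \<times> square set) set" where
  "translation_rel = {(S, T). \<exists>a b. T = translate_by a b S}"

text \<open>
  Skew shapes may sit anywhere in the plane, which makes this set of shapes closed under
  \<^const>\<open>translation_rel\<close>.
\<close>

definition is_skew_shape :: "square set \<Rightarrow> bool" where
  "is_skew_shape S \<longleftrightarrow>
     (\<exists>lam mu a b. is_partition lam \<and> is_partition mu \<and> (\<forall>i. mu i \<le> lam i) \<and>
        S = translate_by a b (skew_diagram lam mu))"

definition adjacent_squares :: "square \<Rightarrow> square \<Rightarrow> bool" where
  "adjacent_squares x y \<longleftrightarrow>
     \<bar>fst x - fst y\<bar> + \<bar>snd x - snd y\<bar> = 1"

definition connected_squares :: "square set \<Rightarrow> bool" where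
  "connected_squares S \<longleftrightarrow>
     (\<forall>x\<in>S. \<forall>y\<in>S. (x, y) \<in> {(u, v). u \<in> S \<and> v \<in> S \<and> adjacent_squares u v}\<^sup>*)"

definition is_rim_hook :: "square set \<Rightarrow> bool" where
  "is_rim_hook S \<longleftrightarrow>
     is_skew_shape S \<and> S \<noteq> {} \<and> connected_squares S \<and>
     (\<nexists>i j. {(i, j), (i, j + 1), (i + 1, j), (i + 1, j + 1)} \<subseteq> S)"

definition is_tableau :: "square set \<Rightarrow> (square \<Rightarrow> nat) \<Rightarrow> bool" where
  "is_tableau S t \<longleftrightarrow>
     bij_betw t S {1..card S} \<and>
     (\<forall>i j. (i, j) \<in> S \<and> (i + 1, j) \<in> S \<longrightarrow> t (i, j) < t (i + 1, j)) \<and>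
     (\<forall>i j. (i, j) \<in> S \<and> (i, j + 1) \<in> S \<longrightarrow> t (i, j) < t (i, j + 1))"

text \<open>The listing of the squares of a rim hook from its bottom-left to its top-right end.\<close>

definition is_reading_order :: "square set \<Rightarrow> square list \<Rightarrow> bool" where
  "is_reading_order S s \<longleftrightarrow>
     distinct s \<and> set s = S \<and>
     (\<forall>k. Suc k < length s \<longrightarrow>
        (let (i, j) = s ! k in s ! Suc k = (i, j + 1) \<or> s ! Suc k = (i - 1, j)))"

text \<open>Permutations of \<open>{1..n}\<close> are written in one-line notation, as lists.\<close>

definition reading_perms :: "square set \<Rightarrow> nat list set" where
  "reading_perms S = {map t s | t s. is_tableau S t \<and> is_reading_order S s}"

text \<open>Positions are counted from 1, so that \<open>w\<^sub>i\<close> is \<open>w ! (i - 1)\<close>.\<close>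

definition double_descent_set :: "nat list \<Rightarrow> nat set" where
  "double_descent_set w =
     {i. 2 \<le> i \<and> i + 1 \<le> length w \<and> w ! (i - 2) > w ! (i - 1) \<and> w ! (i - 1) > w ! i}"

text \<open>
  Rim hooks up to translation are translation classes. The image equation says that there is
  at least one corresponding permutation and that all of them have double descent set \<open>I\<close>.
\<close>

definition rim_hooks_with_dd :: "nat set \<Rightarrow> nat \<Rightarrow> square set set set" where
  "rim_hooks_with_dd I n =
     {S. is_rim_hook S \<and> card S = n \<and> double_descent_set ` reading_perms S = {I}}
       // translation_rel"

end

theory Submission
  imports Defs
begin

text \<open>
  Reading a rim hook from bottom-left to top-right, the content (column minus row) grows by one in
  each step. Conversely, in a rim hook the content is injective, since two squares of equal
  content in a skew shape force a \<open>2 \<times> 2\<close> square, and connectedness forces squares of consecutive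
  contents to be adjacent. So rim hooks of length \<open>n\<close> up to translation are the words of \<open>n - 1\<close>
  steps, each up (\<^term>\<open>True\<close>) or right (\<^term>\<open>False\<close>), and a double descent is a pair of
  consecutive up steps. A word whose only such pair is at a given place consists of two words
  without such pairs on either side of it, and these are counted by Fibonacci numbers.
\<close>

section \<open>Walks\<close>

definition move :: "bool \<Rightarrow> square \<Rightarrow> square" where
  "move b x = (if b then (fst x - 1, snd x) else (fst x, snd x + 1))"

fun walk :: "square \<Rightarrow> bool list \<Rightarrow> square list" where
  "walk x [] = [x]"
| "walk x (b # w) = x # walk (move b x) w"

definition content :: "square \<Rightarrow> int" where
  "content x = snd x - fst x"

lemma content_move [simp]: "content (move b x) = content x + 1"
  by (simp add: content_def move_def)

lemma move_inject [simp]: "move b x = move c x \<longleftrightarrow> b = c"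
  by (auto simp: move_def split: if_splits)

lemma length_walk [simp]: "length (walk x w) = Suc (length w)"
  by (induction w arbitrary: x) auto

lemma walk_not_Nil [simp]: "walk x w \<noteq> []"
  by (cases w) auto

lemma walk_nth_0 [simp]: "walk x w ! 0 = x"
  by (cases w) auto

lemma walk_nth_Suc: "k < length w \<Longrightarrow> walk x w ! Suc k = move (w ! k) (walk x w ! k)"
proof (induction w arbitrary: x k)
  case (Cons b w)
  then show ?case by (cases k) auto
qed simp

lemma walk_snoc: "walk x (w @ [b]) = walk x w @ [move b (last (walk x w))]"
  by (induction w arbitrary: x) auto

lemma content_walk_nth: "k \<le> length w \<Longrightarrow> content (walk x w ! k) = content x + int k"
  by (induction k) (auto simp: walk_nth_Suc)

lemma map_content_walk:
  "map content (walk x w) = map (\<lambda>k. content x + int k) [0..<Suc (length w)]"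
  by (rule nth_equalityI) (auto simp: content_walk_nth simp del: upt_Suc)

lemma distinct_content_walk: "distinct (map content (walk x w))"
  by (simp add: map_content_walk distinct_map inj_on_def del: upt_Suc)

lemma sorted_content_walk: "sorted (map content (walk x w))"
  by (simp add: map_content_walk sorted_iff_nth_mono del: upt_Suc)

lemma distinct_walk: "distinct (walk x w)"
  using distinct_content_walk distinct_map by blast

lemma inj_on_content_walk: "inj_on content (set (walk x w))"
  using distinct_content_walk distinct_map by blast

text \<open>Contents increase along a walk, so a walk is the listing of its squares sorted by
  content, and content is injective on them.\<close>

lemma walk_set_inject:
  assumes "set (walk x w) = set (walk y v)"
  shows "walk x w = walk y v"
proof -
  have "map content (walk x w) = map content (walk y v)"
    using assms by (intro sorted_distinct_set_unique)
      (simp_all add: sorted_content_walk distinct_content_walk)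
  then show ?thesis
    using assms inj_on_content_walk[of x w] by (simp add: inj_on_map_eq_map)
qed

lemma walk_inject: "walk x w = walk y v \<Longrightarrow> x = y \<and> w = v"
proof (induction w arbitrary: x y v)
  case Nil
  then show ?case by (cases v) (auto dest: sym)
next
  case (Cons b w)
  then obtain c v' where v: "v = c # v'" by (cases v) auto
  with Cons.prems have "x = y" "walk (move b x) w = walk (move c y) v'" by auto
  with Cons.IH[of "move b x" "move c y" v'] v show ?case by auto
qed

lemma map_translate_walk:
  "map (\<lambda>(i, j). (i + a, j + b)) (walk x w) = walk (fst x + a, snd x + b) w"
proof (induction w arbitrary: x)
  case (Cons c w)
  have "move c (fst x + a, snd x + b) = (fst (move c x) + a, snd (move c x) + b)"
    by (simp add: move_def)
  with Cons show ?case by (simp add: case_prod_beta)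
qed (simp add: case_prod_beta)

lemma translate_by_walk:
  "translate_by a b (set (walk x w)) = set (walk (fst x + a, snd x + b) w)"
  by (simp only: translate_by_def map_translate_walk[symmetric] set_map)

text \<open>Each step of a reading order is some \<open>move b\<close>; collecting the bits
  \<open>b\<close> gives the word. A walk always contains its starting square, hence the exclusion
  of \<open>[]\<close>.\<close>

lemma is_reading_order_iff_walk:
  "is_reading_order S s \<and> s \<noteq> [] \<longleftrightarrow> (\<exists>x w. s = walk x w \<and> S = set s)"
proof (intro iffI; (elim conjE exE)?)
  have *: "\<exists>w. s = walk (hd s) w" if "s \<noteq> []"
    and "\<forall>k. Suc k < length s \<longrightarrow> (\<exists>b. s ! Suc k = move b (s ! k))" for s
    using that
  proof (induction s)
    case (Cons x s)
    show ?case
    proof (cases s)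
      case Nil
      then have "x # s = walk (hd (x # s)) []" by simp
      then show ?thesis by blast
    next
      case (Cons y t)
      then have "\<exists>b. s ! 0 = move b x"
        using Cons.prems(2)[rule_format, of 0] by simp
      then obtain b where b: "hd s = move b x" using Cons by auto
      have "\<forall>k. Suc k < length s \<longrightarrow> (\<exists>b. s ! Suc k = move b (s ! k))"
        using Cons.prems(2) by (metis Suc_less_eq length_Cons nth_Cons_Suc)
      then obtain w where "s = walk (hd s) w" using Cons.IH Cons by auto
      then have "x # s = walk (hd (x # s)) (b # w)" using b by simp
      then show ?thesis by blast
    qed
  qed simp
  assume s: "is_reading_order S s" "s \<noteq> []"
  then have "\<forall>k. Suc k < length s \<longrightarrow>
      (let (i, j) = s ! k in s ! Suc k = (i, j + 1) \<or> s ! Suc k = (i - 1, j))"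
    by (simp add: is_reading_order_def)
  then have "\<forall>k. Suc k < length s \<longrightarrow> (\<exists>b. s ! Suc k = move b (s ! k))"
    unfolding move_def case_prod_beta Let_def by (metis (full_types))
  with * s show "\<exists>x w. s = walk x w \<and> S = set s"
    unfolding is_reading_order_def by metis
next
  fix x w
  assume "s = walk x w" "S = set s"
  then show "is_reading_order S s \<and> s \<noteq> []"
    by (auto simp: is_reading_order_def distinct_walk walk_nth_Suc move_def case_prod_beta)
qed

lemma reading_orders_walk:
  "is_reading_order (set (walk x w)) s \<longleftrightarrow> s = walk x w"
proof
  assume s: "is_reading_order (set (walk x w)) s"
  then have "s \<noteq> []" by (auto simp: is_reading_order_def)
  with s obtain y v where "s = walk y v" "set (walk x w) = set s"
    using is_reading_order_iff_walk by blast
  then show "s = walk x w" using walk_set_inject by metis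
next
  show "s = walk x w \<Longrightarrow> is_reading_order (set (walk x w)) s"
    using is_reading_order_iff_walk by blast
qed

section \<open>Rim hooks are walks\<close>

text \<open>
  The diagram grows at its top right end: a step to the right extends row \<open>0\<close>, a step up puts a new
  row on top. The last conjunct records where this end is.
\<close>

lemma skew_diagram_walk:
  "\<exists>lam mu a b. is_partition lam \<and> is_partition mu \<and> (\<forall>i. mu i \<le> lam i) \<and> mu 0 < lam 0 \<and>
     set (walk x w) = translate_by a b (skew_diagram lam mu) \<and>
     last (walk x w) = (a, b + int (lam 0) - 1)"
proof (induction w rule: rev_induct)
  case Nil
  let ?lam = "\<lambda>i::nat. if i = 0 then 1 else 0::nat"
  have "is_partition ?lam" "is_partition (\<lambda>i. 0)"
    by (auto simp: is_partition_def antimono_def)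
  moreover have "skew_diagram ?lam (\<lambda>i. 0) = {(0, 0)}"
    by (auto simp: skew_diagram_def)
  ultimately show ?case
    \<comment> \<open>A single square is the diagram of the partition (1), moved from the origin to
      \<open>x\<close>.\<close>
    by - (rule exI[of _ ?lam], rule exI[of _ "\<lambda>i. 0"],
        rule exI[of _ "fst x"], rule exI[of _ "snd x"], simp add: translate_by_def)
next
  case (snoc c w)
  then obtain lam mu a b where
    lam: "is_partition lam" and mu: "is_partition mu" and le: "\<forall>i. mu i \<le> lam i"
    and lt: "mu 0 < lam 0"
    and S: "set (walk x w) = translate_by a b (skew_diagram lam mu)"
    and l: "last (walk x w) = (a, b + int (lam 0) - 1)"
    by blast
  obtain N M where N: "\<forall>i\<ge>N. lam i = 0" and M: "\<forall>i\<ge>M. mu i = 0"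
    using lam mu by (auto simp: is_partition_def)
  have mono: "i \<le> j \<Longrightarrow> lam j \<le> lam i" "i \<le> j \<Longrightarrow> mu j \<le> mu i" for i j
    using lam mu by (auto simp: is_partition_def antimono_def)
  show ?case
  proof (cases c)
    case False
    let ?lam = "lam(0 := lam 0 + 1)"
    have "is_partition ?lam"
      unfolding is_partition_def antimono_def
    proof (intro conjI allI impI)
      show "?lam j \<le> ?lam i" if "i \<le> j" for i j
        using mono(1)[of i j] mono(1)[of 0 j] that by auto
      show "\<exists>N. \<forall>i\<ge>N. ?lam i = 0"
        using N by (intro exI[of _ "Suc N"]) auto
    qed
    moreover have "skew_diagram ?lam mu = insert (0, int (lam 0)) (skew_diagram lam mu)"
    proof -
      have "mu i \<le> j \<and> j < ?lam i \<longleftrightarrow> i = 0 \<and> j = lam 0 \<or> mu i \<le> j \<and> j < lam i" for i j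
        using lt by auto
      then show ?thesis by (auto simp: skew_diagram_def)
    qed
    then have "set (walk x (w @ [c])) = translate_by a b (skew_diagram ?lam mu)"
      using S l False by (simp add: walk_snoc move_def translate_by_def add.commute)
    ultimately show ?thesis
      using mu le lt l False
      by - (rule exI[of _ ?lam], rule exI[of _ mu], rule exI[of _ a], rule exI[of _ b],
        simp add: walk_snoc move_def le_SucI fun_upd_def)
  next
    case True
    \<comment> \<open>\<open>case_nat\<close> pushes the old rows down by one. The new row 0 is the
      single square in column \<open>lam 0 - 1\<close>, right above the old end;
      \<open>mu 0 < lam 0\<close> keeps \<open>?mu\<close> weakly decreasing.\<close>
    let ?lam = "case_nat (lam 0) lam" and ?mu = "case_nat (lam 0 - 1) mu"
    have "is_partition ?lam"
      unfolding is_partition_def antimono_def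
    proof (intro conjI allI impI)
      show "?lam j \<le> ?lam i" if "i \<le> j" for i j
        using that mono(1)[of "i - 1" "j - 1"] mono(1)[of 0 "j - 1"] by (cases i; cases j) auto
      show "\<exists>N. \<forall>i\<ge>N. ?lam i = 0"
        using N by (intro exI[of _ "Suc N"]) (auto split: nat.split)
    qed
    moreover have "is_partition ?mu"
      unfolding is_partition_def antimono_def
    proof (intro conjI allI impI)
      show "?mu j \<le> ?mu i" if "i \<le> j" for i j
        using that mono(2)[of "i - 1" "j - 1"] mono(2)[of 0 "j - 1"] lt by (cases i; cases j) auto
      show "\<exists>N. \<forall>i\<ge>N. ?mu i = 0"
        using M by (intro exI[of _ "Suc M"]) (auto split: nat.split)
    qed
    \<comment> \<open>The offset \<open>a - 1\<close> undoes the downward shift of the old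
      rows.\<close>
    moreover have "set (walk x (w @ [c])) = translate_by (a - 1) b (skew_diagram ?lam ?mu)"
    proof -
      have "skew_diagram ?lam ?mu
          = insert (0, int (lam 0) - 1) (translate_by 1 0 (skew_diagram lam mu))"
      proof -
        have row0: "?mu 0 \<le> j \<and> j < ?lam 0 \<longleftrightarrow> int j = int (lam 0) - 1" for j
          using lt by auto
        have rows: "skew_diagram ?lam ?mu = {(int 0, int j) | j. ?mu 0 \<le> j \<and> j < ?lam 0} \<union>
            {(int (Suc i), int j) | i j. ?mu (Suc i) \<le> j \<and> j < ?lam (Suc i)}"
        proof -
          have "{f i j | i j. R i j} = {f 0 j | j. R 0 j} \<union> {f (Suc i) j | i j. R (Suc i) j}"
            for f :: "nat \<Rightarrow> nat \<Rightarrow> square" and R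
            by (intro equalityI subsetI; clarsimp) (metis nat.exhaust, blast)
          then show ?thesis unfolding skew_diagram_def .
        qed
        have "{(int 0, int j) | j. ?mu 0 \<le> j \<and> j < ?lam 0} = {(0, int (lam 0) - 1)}"
          unfolding row0 using lt by (auto intro!: exI[of _ "lam 0 - 1"])
        moreover have "{(int (Suc i), int j) | i j. ?mu (Suc i) \<le> j \<and> j < ?lam (Suc i)} =
            translate_by 1 0 (skew_diagram lam mu)"
          by (fastforce simp: skew_diagram_def translate_by_def image_iff)
        ultimately show ?thesis unfolding rows by simp
      qed
      moreover have "translate_by (a - 1) b (translate_by 1 0 (skew_diagram lam mu))
          = translate_by a b (skew_diagram lam mu)"
        by (simp add: translate_by_def image_image case_prod_beta algebra_simps)
      ultimately show ?thesis
        using S l True by (simp add: walk_snoc move_def translate_by_def algebra_simps)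
    qed
    moreover have "\<forall>i. ?mu i \<le> ?lam i"
      using le by (auto split: nat.split)
    ultimately show ?thesis
      using lt l True
      by - (rule exI[of _ ?lam], rule exI[of _ ?mu], rule exI[of _ "a - 1"], rule exI[of _ b],
        simp add: walk_snoc move_def del: One_nat_def)
  qed
qed

lemma adjacent_squares_sym: "adjacent_squares x y \<longleftrightarrow> adjacent_squares y x"
  by (auto simp: adjacent_squares_def abs_minus_commute)

text \<open>The start reaches every square along the walk, and adjacency is symmetric, so any two
  squares are linked through the start.\<close>

lemma connected_walk: "connected_squares (set (walk x w))"
proof -
  define R where "R = {(u, v). u \<in> set (walk x w) \<and> v \<in> set (walk x w) \<and> adjacent_squares u v}"
  have symR: "sym (R\<^sup>*)"
    by (intro sym_rtrancl) (auto simp: R_def sym_def adjacent_squares_sym)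
  have "(x, walk x w ! k) \<in> R\<^sup>*" if "k \<le> length w" for k
    using that
  proof (induction k)
    case (Suc k)
    have "(walk x w ! k, walk x w ! Suc k) \<in> R"
      using Suc.prems by (auto simp: R_def adjacent_squares_def walk_nth_Suc[symmetric])
        (simp add: walk_nth_Suc move_def)
    with Suc show ?case by (auto intro: rtrancl_into_rtrancl)
  qed simp
  then have "(x, y) \<in> R\<^sup>*" if "y \<in> set (walk x w)" for y
    using that by (auto simp: in_set_conv_nth less_Suc_eq_le)
  then show ?thesis
    unfolding connected_squares_def R_def[symmetric]
    by (meson rtrancl_trans symD symR)
qed

lemma is_rim_hook_walk: "is_rim_hook (set (walk x w))"
proof -
  have "is_skew_shape (set (walk x w))"
    using skew_diagram_walk[of x w] unfolding is_skew_shape_def by blast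
  \<comment> \<open>The top-left and bottom-right corners of a 2 x 2 square have equal
    content.\<close>
  moreover have "\<not> {(i, j), (i, j + 1), (i + 1, j), (i + 1, j + 1)} \<subseteq> set (walk x w)" for i j
    using inj_onD[OF inj_on_content_walk[of x w], of "(i, j)" "(i + 1, j + 1)"]
    by (auto simp: content_def)
  ultimately show ?thesis
    by (simp add: is_rim_hook_def connected_walk)
qed

section \<open>From rim hooks back to walks\<close>

text \<open>Both row bounds decrease weakly downwards: the bound \<open>mu\<close> in row
  \<open>i'\<close> is at most its value in row \<open>i\<close>, and \<open>lam\<close> in row
  \<open>i'\<close> is at least its value in row \<open>k\<close>.\<close>

lemma skew_shape_convex:
  assumes "is_skew_shape S" "(i, j) \<in> S" "(k, l) \<in> S" "i \<le> i'" "i' \<le> k" "j \<le> j'" "j' \<le> l"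
  shows "(i', j') \<in> S"
proof -
  obtain lam mu a b where "antimono lam" "antimono mu"
    and S: "S = translate_by a b (skew_diagram lam mu)"
    using assms(1) by (auto simp: is_skew_shape_def is_partition_def)
  then have mono: "p \<le> q \<Longrightarrow> lam q \<le> lam p" "p \<le> q \<Longrightarrow> mu q \<le> mu p" for p q
    by (auto simp: antimono_def)
  obtain p q where pq: "i = int p + a" "j = int q + b" "mu p \<le> q" "q < lam p"
    using assms(2) by (auto simp: S translate_by_def skew_diagram_def)
  obtain r s where rs: "k = int r + a" "l = int s + b" "mu r \<le> s" "s < lam r"
    using assms(3) by (auto simp: S translate_by_def skew_diagram_def)
  \<comment> \<open>\<open>nat\<close> truncates nothing here, since
    \<open>a \<le> i \<le> i'\<close> and \<open>b \<le> j \<le> j'\<close>.\<close>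
  define p' q' where "p' = nat (i' - a)" and "q' = nat (j' - b)"
  have eq: "i' = int p' + a" "j' = int q' + b"
    using assms pq by (auto simp: p'_def q'_def)
  have "p \<le> p'" "p' \<le> r" "q \<le> q'" "q' \<le> s"
    using assms pq rs eq by auto
  then have "mu p' \<le> q'" "q' < lam p'"
    using mono(2)[of p p'] mono(1)[of p' r] pq rs by auto
  then have "(int p', int q') \<in> skew_diagram lam mu"
    by (auto simp: skew_diagram_def)
  then show ?thesis
    unfolding S translate_by_def eq by (rule rev_image_eqI) simp
qed

text \<open>Of two distinct squares on a diagonal, one lies strictly above and to the left of the
  other. The rectangle they span is in \<open>S\<close> by convexity and contains a 2 x 2
  square.\<close>

lemma inj_on_content_rim_hook:
  assumes "is_rim_hook S"
  shows "inj_on content S"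
proof -
  have neq: False
    if "(i, j) \<in> S" "(k, l) \<in> S" "i < k" "j - i = l - k" for i j k l
  proof -
    have skew: "is_skew_shape S" using assms by (simp add: is_rim_hook_def)
    have "{(i, j), (i, j + 1), (i + 1, j), (i + 1, j + 1)} \<subseteq> S"
      using that by (auto intro!: skew_shape_convex[OF skew that(1,2)])
    with assms show False unfolding is_rim_hook_def by blast
  qed
  show ?thesis
  proof (rule inj_onI)
    fix x y assume *: "x \<in> S" "y \<in> S" "content x = content y"
    moreover have "\<not> fst x < fst y" "\<not> fst y < fst x"
      using neq[of "fst x" "snd x" "fst y" "snd y"] neq[of "fst y" "snd y" "fst x" "snd x"] *
      by (auto simp: content_def)
    ultimately show "x = y"
      by (simp add: content_def prod_eq_iff)
  qed
qed

lemma adjacent_content_move: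
  assumes "adjacent_squares x y" "content y = content x + 1"
  shows "\<exists>b. y = move b x"
proof -
  have "y = move False x \<or> y = move True x"
    using assms by (auto simp: adjacent_squares_def content_def move_def prod_eq_iff)
  then show ?thesis by blast
qed

lemma adjacent_content: "adjacent_squares x y \<Longrightarrow> \<bar>content y - content x\<bar> = 1"
  unfolding adjacent_squares_def content_def by arith

text \<open>A path from \<open>x\<close> to \<open>y\<close> inside \<open>S\<close> changes content
  by one per step, so some step climbs from \<open>content x\<close> to
  \<open>content x + 1\<close>. By injectivity of content that step starts at \<open>x\<close>
  itself.\<close>

lemma rim_hook_next:
  assumes "is_rim_hook S" "x \<in> S" "y \<in> S" "content x < content y"
  shows "\<exists>b. move b x \<in> S"
proof -
  let ?R = "{(u, v). u \<in> S \<and> v \<in> S \<and> adjacent_squares u v}"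
  have "(x, y) \<in> ?R\<^sup>*"
    using assms by (auto simp: is_rim_hook_def connected_squares_def)
  \<comment> \<open>Invariant along the path: either it is still at or below the level of
    \<open>x\<close>, or the crossing step has occurred.\<close>
  then have "content y \<le> content x \<or> 
      (\<exists>u v. (u, v) \<in> ?R \<and> content u = content x \<and> content v = content x + 1)"
  proof (induction rule: rtrancl_induct)
    case (step u v)
    then show ?case
    proof (elim disjE)
      assume "content u \<le> content x"
      then show ?thesis
        using step(2) adjacent_content[of u v] by (cases "content u = content x") fastforce+
    qed blast
  qed simp
  then obtain u v where uv: "u \<in> S" "v \<in> S" "adjacent_squares u v" "content u = content x"
      "content v = content x + 1"
    using assms(4) by auto
  then have "u = x" using inj_on_content_rim_hook assms by (metis inj_onD)
  then show ?thesis using adjacent_content_move uv by metis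
qed

text \<open>Starting at the square of least content, moves are made inside \<open>S\<close> as long
  as possible; injectivity of content ensures that no square is missed.\<close>

lemma rim_hook_is_walk:
  assumes S: "is_rim_hook S"
  shows "\<exists>x w. S = set (walk x w)"
proof -
  have fin: "finite S"
  proof -
    obtain lam mu a b where lam: "is_partition lam"
      and Sl: "S = translate_by a b (skew_diagram lam mu)"
      using S by (auto simp: is_rim_hook_def is_skew_shape_def)
    obtain N where N: "\<forall>i\<ge>N. lam i = 0" and mono: "antimono lam"
      using lam by (auto simp: is_partition_def)
    \<comment> \<open>The diagram fits into a box with \<open>N\<close> rows and
      \<open>lam 0\<close> columns.\<close>
    have "skew_diagram lam mu \<subseteq> (\<lambda>(i, j). (int i, int j)) ` ({..<N} \<times> {..<lam 0})"
    proof -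
      have "i < N \<and> j < lam 0" if "j < lam i" for i j
        using that N antimonoD[OF mono, of 0 i] by (metis less_le_trans not_less not_less0 zero_le)
      then show ?thesis by (force simp: skew_diagram_def)
    qed
    then have "finite (skew_diagram lam mu)" by (rule finite_subset) simp
    then show ?thesis by (simp add: Sl translate_by_def)
  qed
  have upper: "\<exists>w. set (walk x w) = {y \<in> S. content x \<le> content y}" if "x \<in> S" for x
    using that
  proof (induction "card {y \<in> S. content x < content y}" arbitrary: x rule: less_induct)
    case less
    \<comment> \<open>By injectivity, \<open>x\<close> is the only square of \<open>S\<close> with
      its content.\<close>
    have eq: "y \<in> S \<and> content x \<le> content y \<longleftrightarrow> y = x \<or> y \<in> S \<and> content x < content y" for y
      using less.prems inj_onD[OF inj_on_content_rim_hook[OF S], of x y]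
      by (cases "y = x") (auto simp: le_less)
    show ?case
    proof (cases "\<exists>b. move b x \<in> S")
      case True
      then obtain b where b: "move b x \<in> S" by blast
      have "card {y \<in> S. content (move b x) < content y} < card {y \<in> S. content x < content y}"
      proof (rule psubset_card_mono)
        show "{y \<in> S. content (move b x) < content y} \<subset> {y \<in> S. content x < content y}"
        proof
          show "{y \<in> S. content (move b x) < content y} \<subseteq> {y \<in> S. content x < content y}"
            by auto
          have "move b x \<in> {y \<in> S. content x < content y}"
            "move b x \<notin> {y \<in> S. content (move b x) < content y}"
            using b by simp_all
          then show "{y \<in> S. content (move b x) < content y} \<noteq> {y \<in> S. content x < content y}"
            by metis
        qed
      qed (use fin in simp)
      then obtain w where "set (walk (move b x) w) = {y \<in> S. content (move b x) \<le> content y}"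
        using less b by blast
      then have "set (walk x (b # w)) = insert x {y \<in> S. content x < content y}"
        by (simp add: add1_zle_eq)
      also have "\<dots> = {y \<in> S. content x \<le> content y}"
        unfolding eq by auto
      finally show ?thesis by blast
    next
      case False
      \<comment> \<open>With no move available, \<open>x\<close> has the greatest content, so the
        empty word suffices.\<close>
      then have "\<not> content x < content y" if "y \<in> S" for y
        using rim_hook_next[OF S less.prems that] by blast
      then have "set (walk x []) = {y \<in> S. content x \<le> content y}"
        unfolding eq by auto
      then show ?thesis by blast
    qed
  qed
  obtain x where x: "x \<in> S" "\<And>y. y \<in> S \<Longrightarrow> content x \<le> content y"
  proof -
    have ne: "content ` S \<noteq> {}" "finite (content ` S)"
      using S fin by (auto simp: is_rim_hook_def)
    then obtain x where "x \<in> S" "Min (content ` S) = content x"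
      using Min_in by blast
    with ne that show thesis by (metis Min_le imageI)
  qed
  then have "{y \<in> S. content x \<le> content y} = S" by blast
  then show ?thesis using upper[OF x(1)] by metis
qed

section \<open>Double descents of the reading permutations\<close>

text \<open>Numbering the squares of a finite set row by row gives a tableau.\<close>

lemma is_tableau_exists:
  assumes "finite S"
  shows "\<exists>t. is_tableau S t"
proof -
  define lt :: "square \<Rightarrow> square \<Rightarrow> bool"
    where "lt x y \<longleftrightarrow> fst x < fst y \<or> fst x = fst y \<and> snd x < snd y" for x y
  \<comment> \<open>The rank of \<open>x\<close> in the order \<open>lt\<close>; counting
    \<open>x\<close> itself makes ranks start at 1.\<close>
  define t where "t x = card {y \<in> S. y = x \<or> lt y x}" for x
  have less: "t x < t y" if "x \<in> S" "y \<in> S" "lt x y" for x y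
    unfolding t_def using assms that
    by (intro psubset_card_mono psubsetI notI)
      (auto simp: lt_def dest: equalityD2[THEN subsetD, of _ _ y])
  have "inj_on t S"
  proof (rule inj_onI)
    fix x y assume *: "x \<in> S" "y \<in> S" "t x = t y"
    have "x = y \<or> lt x y \<or> lt y x"
      by (auto simp: lt_def prod_eq_iff)
    with * less[of x y] less[of y x] show "x = y" by auto
  qed
  moreover have "t x \<in> {1..card S}" if "x \<in> S" for x
  proof -
    have "{y \<in> S. y = x \<or> lt y x} \<noteq> {}" using that by blast
    then show ?thesis
      using assms by (auto simp: t_def Suc_le_eq card_gt_0_iff intro!: card_mono)
  qed
  then have "t ` S \<subseteq> {1..card S}" by blast
  ultimately have "bij_betw t S {1..card S}"
    by (simp add: bij_betw_def card_image card_subset_eq)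
  then have "is_tableau S t"
    unfolding is_tableau_def by (auto intro!: less simp: lt_def)
  then show ?thesis by blast
qed

text \<open>Positions count from 0. Steps \<open>k\<close> and \<open>k + 1\<close> join the squares
  numbered \<open>k + 1\<close>, \<open>k + 2\<close> and \<open>k + 3\<close> counted from 1, so
  they produce a double descent at \<open>k + 2\<close>.\<close>

definition up_up_positions :: "bool list \<Rightarrow> nat set" where
  "up_up_positions w = {k. Suc k < length w \<and> w ! k \<and> w ! Suc k}"

text \<open>Entries grow downwards and to the right, so an up step lowers the entry and a right step
  raises it: descents depend on the word alone.\<close>

lemma tableau_descent_iff_up:
  assumes t: "is_tableau (set (walk x w)) t" and k: "k < length w"
  shows "t (walk x w ! Suc k) < t (walk x w ! k) \<longleftrightarrow> w ! k"
proof -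
  obtain i j where ij: "walk x w ! k = (i, j)" by fastforce
  have mem: "walk x w ! k \<in> set (walk x w)" "walk x w ! Suc k \<in> set (walk x w)"
    using k by auto
  have up: "t (i', j') < t (i' + 1, j')"
    if "(i', j') \<in> set (walk x w)" "(i' + 1, j') \<in> set (walk x w)" for i' j'
    using t that by (auto simp: is_tableau_def)
  have right: "t (i', j') < t (i', j' + 1)"
    if "(i', j') \<in> set (walk x w)" "(i', j' + 1) \<in> set (walk x w)" for i' j'
    using t that by (auto simp: is_tableau_def)
  show ?thesis
    using mem up[of "i - 1" j] right[of i j] by (auto simp: walk_nth_Suc[OF k] ij move_def)
qed

lemma double_descent_set_walk:
  assumes "is_tableau (set (walk x w)) t"
  shows "double_descent_set (map t (walk x w)) = (\<lambda>k. k + 2) ` up_up_positions w"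
proof -
  have "i \<in> double_descent_set (map t (walk x w)) \<longleftrightarrow>
      i \<in> (\<lambda>k. k + 2) ` up_up_positions w" for i
  proof (cases "2 \<le> i")
    case True
    then obtain k where i: "i = Suc (Suc k)" by (metis add_2_eq_Suc le_Suc_ex)
    show ?thesis
      using tableau_descent_iff_up[OF assms, of k] tableau_descent_iff_up[OF assms, of "Suc k"]
      by (auto simp: i double_descent_set_def up_up_positions_def image_iff)
  qed (auto simp: double_descent_set_def)
  then show ?thesis by blast
qed

text \<open>Existence of a tableau makes the image nonempty; all its members agree because the
  double descents are read off the word.\<close>

lemma double_descent_set_reading_perms:
  "double_descent_set ` reading_perms (set (walk x w)) = {(\<lambda>k. k + 2) ` up_up_positions w}"
proof -
  obtain t where "is_tableau (set (walk x w)) t" using is_tableau_exists by blast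
  then have "reading_perms (set (walk x w)) \<noteq> {}"
    by (auto simp: reading_perms_def reading_orders_walk)
  moreover have "double_descent_set p = (\<lambda>k. k + 2) ` up_up_positions w"
    if "p \<in> reading_perms (set (walk x w))" for p
    using that double_descent_set_walk unfolding reading_perms_def reading_orders_walk by blast
  ultimately show ?thesis by blast
qed

section \<open>Translation classes as words\<close>

lemma rim_hook_dd_iff:
  "is_rim_hook S \<and> card S = n \<and> double_descent_set ` reading_perms S = {(\<lambda>k. k + 2) ` K} \<longleftrightarrow>
    (\<exists>x w. S = set (walk x w) \<and> Suc (length w) = n \<and> up_up_positions w = K)"
proof -
  have "inj (\<lambda>k::nat. k + 2)" by (simp add: inj_def)
  then have "(\<lambda>k. k + 2) ` up_up_positions w = (\<lambda>k. k + 2) ` K \<longleftrightarrow> up_up_positions w = K" for w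
    by (rule inj_image_eq_iff)
  moreover have "card (set (walk x w)) = Suc (length w)" for x w
    by (simp add: distinct_card distinct_walk)
  ultimately have "is_rim_hook (set (walk x w)) \<and> card (set (walk x w)) = n \<and>
      double_descent_set ` reading_perms (set (walk x w)) = {(\<lambda>k. k + 2) ` K} \<longleftrightarrow>
      Suc (length w) = n \<and> up_up_positions w = K" for x w
    by (simp add: is_rim_hook_walk double_descent_set_reading_perms)
  then show ?thesis using rim_hook_is_walk by metis
qed

text \<open>Translation moves the start of a walk and keeps its word, so the class of a walk
  consists of all walks with that word, called \<open>C w\<close> below.\<close>

lemma card_rim_hooks_with_dd:
  "card (rim_hooks_with_dd ((\<lambda>k. k + 2) ` K) (Suc l)) =
    card {w. length w = l \<and> up_up_positions w = K}"
proof -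
  define W where "W = {w. length w = l \<and> up_up_positions w = K}"
  define C where "C w = range (\<lambda>y. set (walk y w))" for w
  have cls: "translation_rel `` {set (walk x w)} = C w" for x w
  proof (intro equalityI subsetI)
    fix T assume "T \<in> C w"
    then obtain y where "T = set (walk y w)" by (auto simp: C_def)
    then have "T = translate_by (fst y - fst x) (snd y - snd x) (set (walk x w))"
      by (simp add: translate_by_walk)
    then show "T \<in> translation_rel `` {set (walk x w)}"
      by (auto simp: translation_rel_def)
  qed (auto simp: translation_rel_def C_def translate_by_walk)
  have "{S. \<exists>x w. S = set (walk x w) \<and> Suc (length w) = Suc l \<and> up_up_positions w = K} =
      (\<lambda>(x, w). set (walk x w)) ` (UNIV \<times> W)"
    by (auto simp: W_def image_iff)
  then have "rim_hooks_with_dd ((\<lambda>k. k + 2) ` K) (Suc l) =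
      (\<Union>(x, w) \<in> UNIV \<times> W. {translation_rel `` {set (walk x w)}})"
    unfolding rim_hooks_with_dd_def rim_hook_dd_iff quotient_def
    by (simp add: case_prod_beta)
  also have "\<dots> = C ` W"
    by (auto simp: cls)
  finally have "rim_hooks_with_dd ((\<lambda>k. k + 2) ` K) (Suc l) = C ` W" .
  moreover have "inj_on C W"
  proof (rule inj_onI)
    fix w v assume "C w = C v"
    then have "set (walk (0, 0) w) \<in> C v" unfolding C_def by blast
    then obtain y where "set (walk (0, 0) w) = set (walk y v)" unfolding C_def by blast
    \<comment> \<open>A common member of both classes determines its walk, and hence its
      word.\<close>
    then show "w = v" using walk_set_inject walk_inject by blast
  qed
  ultimately show ?thesis by (simp add: card_image W_def)
qed

section \<open>Counting words\<close>

definition no_up_up :: "bool list \<Rightarrow> bool" where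
  "no_up_up = successively (\<lambda>a b. \<not> (a \<and> b))"

lemma up_up_positions_empty_iff: "up_up_positions w = {} \<longleftrightarrow> no_up_up w"
  by (auto simp: up_up_positions_def no_up_up_def successively_conv_nth)

text \<open>The two pieces overlap in the letter \<open>a\<close>, so every pair of neighbouring
  letters lies within exactly one of them.\<close>

lemma up_up_positions_append:
  "up_up_positions (u @ a # v) =
    up_up_positions (u @ [a]) \<union> (+) (length u) ` up_up_positions (a # v)"
proof -
  have "k \<in> up_up_positions (u @ a # v) \<longleftrightarrow>
    k \<in> up_up_positions (u @ [a]) \<union> (+) (length u) ` up_up_positions (a # v)" for k
  proof (cases "k < length u")
    case True
    then show ?thesis
      by (auto simp: up_up_positions_def nth_append less_Suc_eq)
  next
    case False
    then obtain d where "k = length u + d" by (metis le_Suc_ex not_less)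
    then show ?thesis
      by (auto simp: up_up_positions_def nth_append image_iff)
  qed
  then show ?thesis by blast
qed

text \<open>The middle pair always contributes \<open>length u\<close>. Any other pair lies in
  \<open>u @ [True]\<close> or in \<open>True # v\<close>, each of which keeps one letter of the
  middle pair.\<close>

lemma up_up_positions_singleton_iff:
  "up_up_positions (u @ True # True # v) = {length u} \<longleftrightarrow>
    no_up_up (u @ [True]) \<and> no_up_up (True # v)"
proof -
  have "up_up_positions (True # True # v) = insert 0 (Suc ` up_up_positions (True # v))"
    using up_up_positions_append[of "[True]" True v]
    by (auto simp: up_up_positions_def less_Suc_eq)
  then have "up_up_positions (u @ True # True # v) =
      insert (length u)
        (up_up_positions (u @ [True]) \<union> (\<lambda>k. length u + Suc k) ` up_up_positions (True # v))"
    by (simp add: up_up_positions_append[of u True "True # v"] image_image)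
  moreover have "length u \<notin> up_up_positions (u @ [True])"
    by (simp add: up_up_positions_def)
  ultimately show ?thesis
    unfolding up_up_positions_empty_iff[symmetric] by auto
qed

lemma words_Suc:
  "{w :: bool list. length w = Suc k \<and> P w} =
    (#) False ` {w. length w = k \<and> P (False # w)} \<union> (#) True ` {w. length w = k \<and> P (True # w)}"
proof (intro equalityI subsetI)
  fix w :: "bool list" assume "w \<in> {w. length w = Suc k \<and> P w}"
  then obtain b u where "w = b # u" "length u = k" "P (b # u)" by (cases w) auto
  then show "w \<in> (#) False ` {w. length w = k \<and> P (False # w)} \<union>
      (#) True ` {w. length w = k \<and> P (True # w)}"
    by (cases b) auto
qed auto

text \<open>Both counts are proved together, by splitting on the first letter: after
  \<open>False\<close> the rest is any admissible word, while after \<open>True\<close> a further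
  letter must be \<open>False\<close>. This yields the Fibonacci recurrence.\<close>

lemma card_no_up_up:
  "card {w. length w = k \<and> no_up_up w} = fib (k + 2)"
  "card {w. length w = k \<and> no_up_up (True # w)} = fib (k + 1)"
proof (induction k)
  case 0
  have "{w. length w = 0 \<and> no_up_up w} = {[]}" "{w. length w = 0 \<and> no_up_up (True # w)} = {[]}"
    by (auto simp: no_up_up_def)
  then show "card {w. length w = 0 \<and> no_up_up w} = fib (0 + 2)"
    "card {w. length w = 0 \<and> no_up_up (True # w)} = fib (0 + 1)"
    by (simp_all add: numeral_2_eq_2)
next
  case (Suc k)
  have fin: "finite {w :: bool list. length w = k \<and> P w}" for P
    by (rule finite_subset[OF _ finite_lists_length_eq[of UNIV k]]) auto
  have False_Cons: "no_up_up (False # w) \<longleftrightarrow> no_up_up w"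
    and True_True_Cons: "no_up_up (True # True # w) \<longleftrightarrow> False"
    and True_False_Cons: "no_up_up (True # False # w) \<longleftrightarrow> no_up_up w" for w
    by (cases w; simp add: no_up_up_def)+
  have "card {w. length w = Suc k \<and> no_up_up w} =
      card {w. length w = k \<and> no_up_up w} + card {w. length w = k \<and> no_up_up (True # w)}"
    unfolding words_Suc[of k no_up_up] False_Cons
    by (subst card_Un_disjoint) (auto simp: fin card_image)
  with Suc show "card {w. length w = Suc k \<and> no_up_up w} = fib (Suc k + 2)"
    by simp
  have "card {w. length w = Suc k \<and> no_up_up (True # w)} = card {w. length w = k \<and> no_up_up w}"
    unfolding words_Suc[of k "\<lambda>w. no_up_up (True # w)"] True_True_Cons True_False_Cons
    by (simp add: card_image)
  with Suc show "card {w. length w = Suc k \<and> no_up_up (True # w)} = fib (Suc k + 1)"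
    by simp
qed

text \<open>Reversal preserves the symmetric condition \<open>no_up_up\<close> and moves the final
  \<open>True\<close> to the front.\<close>

lemma card_no_up_up_snoc:
  "card {w. length w = k \<and> no_up_up (w @ [True])} = fib (k + 1)"
proof -
  have rev: "no_up_up (rev w @ [True]) \<longleftrightarrow> no_up_up (True # w)" for w
    using successively_rev[of "\<lambda>a b. \<not> (a \<and> b)" "True # w"]
    by (simp add: no_up_up_def conj_commute)
  then have "{w. length w = k \<and> no_up_up (w @ [True])} = rev ` {w. length w = k \<and> no_up_up (True # w)}"
    by (auto simp: image_iff) (metis length_rev rev_rev_ident)
  then show ?thesis by (simp add: card_image card_no_up_up)
qed

text \<open>Cutting out the marked pair leaves \<open>k\<close> letters before it and
  \<open>l\<close> after it, which can be chosen independently.\<close>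

lemma card_up_up_singleton:
  "card {w. length w = k + 2 + l \<and> up_up_positions w = {k}} = fib (k + 1) * fib (l + 1)"
proof -
  let ?L = "{u. length u = k \<and> no_up_up (u @ [True])}"
  let ?R = "{v. length v = l \<and> no_up_up (True # v)}"
  let ?f = "\<lambda>(u, v). u @ True # True # v"
  have "{w. length w = k + 2 + l \<and> up_up_positions w = {k}} = ?f ` (?L \<times> ?R)"
  proof (intro equalityI subsetI)
    fix w assume "w \<in> {w. length w = k + 2 + l \<and> up_up_positions w = {k}}"
    then have len: "length w = k + 2 + l" and w: "up_up_positions w = {k}" by auto
    then have "w ! k" "w ! Suc k" by (auto simp: up_up_positions_def)
    then have eq: "w = take k w @ True # True # drop (Suc (Suc k)) w"
      using len id_take_nth_drop[of k w] Cons_nth_drop_Suc[of "Suc k" w] by simp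
    have "length (take k w) = k" using len by simp
    then have "no_up_up (take k w @ [True]) \<and> no_up_up (True # drop (Suc (Suc k)) w)"
      using w eq up_up_positions_singleton_iff[of "take k w" "drop (Suc (Suc k)) w"] by simp
    then have "(take k w, drop (Suc (Suc k)) w) \<in> ?L \<times> ?R"
      using len by simp
    then show "w \<in> ?f ` (?L \<times> ?R)"
      by (rule rev_image_eqI) (simp add: eq[symmetric])
  next
    fix w assume "w \<in> ?f ` (?L \<times> ?R)"
    then show "w \<in> {w. length w = k + 2 + l \<and> up_up_positions w = {k}}"
      using up_up_positions_singleton_iff by auto
  qed
  moreover have "inj_on ?f (?L \<times> ?R)"
    by (auto simp: inj_on_def)
  ultimately show ?thesis
    by (simp add: card_image card_cartesian_product card_no_up_up card_no_up_up_snoc)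
qed

theorem theorem4p1:
  fixes m n :: nat
  assumes "m \<ge> 2" and "n \<ge> m + 1"
  shows "card (rim_hooks_with_dd {m} n) = fib (n - m) * fib (m - 1)"
proof -
  \<comment> \<open>Of the \<open>n - 1\<close> steps, \<open>k\<close> precede the pair of up steps
    and \<open>l\<close> follow it; thus \<open>m - 1 = k + 1\<close> and
    \<open>n - m = l + 1\<close>.\<close>
  obtain k where k: "m = k + 2" using assms(1) by (metis add.commute le_Suc_ex)
  then obtain l where n: "n = Suc (k + 2 + l)"
    using assms(2) by (metis Suc_eq_plus1 add_Suc le_Suc_ex)
  have "card (rim_hooks_with_dd {m} n) = fib (k + 1) * fib (l + 1)"
    using card_rim_hooks_with_dd[of "{k}" "k + 2 + l"] card_up_up_singleton[of k l]
    by (simp add: k n)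
  then show ?thesis by (simp add: k n)
qed

end
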